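(* Let $\Gamma$ be a mixed graph with Hermitian adjacency matrix $H$, and let $u$ and $v$ be two distinct vertices of $\Gamma$. Let $m_H(x)$ be the minimal polynomial of $H$, and let $s=\deg m_H$. Then there is zero transfer between $u$ and $v$ if and only if $(H^k)_{u,v}=0$ for all integers $k$ with $1\le k\le s-1$.
   Context: A mixed graph $\Gamma=(V,E,A)$ consists of a finite vertex set $V$, a set $E$ of undirected edges and a set $A$ of directed edges (arcs), with no loops and at most one edge or arc between any two vertices. Its Hermitian adjacency matrix $H=(h_{uv})_{u,v\in V}$ is defined by $h_{uv}=1$ if $\{u,v\}\in E$, $h_{uv}=\mathrm{i}$ if $(u,v)\in A$, $h_{uv}=-\mathrm{i}$ if $(v,u)\in A$, and $h_{uv}=0$ otherwise, where $\mathrm{i}=\sqrt{-1}$. The transition matrix is $U(t)=\exp(-\mathrm{i}tH)$, $t\in\mathbb{R}$. There is zero transfer between vertices $u$ and $v$ if $U(t)_{u,v}=0$ for all $t\ge 0$ (this condition is symmetric in $u$ and $v$). *)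

theory Defs
  imports "HOL-Analysis.Analysis" "HOL-Computational_Algebra.Polynomial"
begin

(* The vertex set is the (arbitrary) finite type 'v; undirected edges are two-element sets,
   arcs are ordered pairs. *)

locale mixed_graph =
  fixes E :: "'v::finite set set" and A :: "('v \<times> 'v) set"
  assumes edge_card: "e \<in> E \<Longrightarrow> card e = 2"
    and arc_no_loop: "(u, u) \<notin> A"
    and arc_not_reversed: "(u, v) \<in> A \<Longrightarrow> (v, u) \<notin> A"
    and arc_not_edge: "(u, v) \<in> A \<Longrightarrow> {u, v} \<notin> E"

definition hermitian_adj :: "'v::finite set set \<Rightarrow> ('v \<times> 'v) set \<Rightarrow> complex^'v^'v" where
  "hermitian_adj E A = (\<chi> u v.
     if {u, v} \<in> E then 1
     else if (u, v) \<in> A then \<i>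
     else if (v, u) \<in> A then - \<i>
     else 0)"

(* On the type of square matrices, the class operations * and ^ act componentwise,
   so powers with respect to ** have to be defined separately. *)

primrec matrix_pow :: "complex^'n^'n \<Rightarrow> nat \<Rightarrow> complex^'n^'n" where
  "matrix_pow M 0 = mat 1"
| "matrix_pow M (Suc k) = M ** matrix_pow M k"

definition matrix_scale :: "complex \<Rightarrow> complex^'n^'n \<Rightarrow> complex^'n^'n" where
  "matrix_scale c M = (\<chi> i j. c * M $ i $ j)"

definition matrix_exp :: "complex^'n^'n \<Rightarrow> complex^'n^'n" where
  "matrix_exp M = (\<Sum>k. matrix_scale (1 / fact k) (matrix_pow M k))"

definition matrix_poly :: "complex poly \<Rightarrow> complex^'n^'n \<Rightarrow> complex^'n^'n" where
  "matrix_poly p M = (\<Sum>k\<le>degree p. matrix_scale (coeff p k) (matrix_pow M k))"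

definition minimal_poly :: "complex^'n^'n \<Rightarrow> complex poly" where
  "minimal_poly M = (THE p. lead_coeff p = 1 \<and> matrix_poly p M = 0 \<and>
     (\<forall>q. q \<noteq> 0 \<and> matrix_poly q M = 0 \<longrightarrow> degree p \<le> degree q))"

definition transition_matrix :: "complex^'n^'n \<Rightarrow> real \<Rightarrow> complex^'n^'n" where
  "transition_matrix H t = matrix_exp (matrix_scale (- \<i> * complex_of_real t) H)"

definition zero_transfer ::
  "'v::finite set set \<Rightarrow> ('v \<times> 'v) set \<Rightarrow> 'v \<Rightarrow> 'v \<Rightarrow> bool" where
  "zero_transfer E A u v \<longleftrightarrow>
     (\<forall>t\<ge>0. transition_matrix (hermitian_adj E A) t $ u $ v = 0)"

end

theory Submission
  imports Defs "HOL-Complex_Analysis.Cauchy_Integral_Formula"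
begin

text \<open>
  The entry \<open>U(t)\<^sub>u\<^sub>v\<close> is the sum of an everywhere convergent power series in \<open>t\<close> whose coefficients
  are nonzero multiples of the entries \<open>(H\<^sup>k)\<^sub>u\<^sub>v\<close>. Nonzero power series have isolated zeros, so the
  entry vanishes for all \<open>t \<ge> 0\<close> iff \<open>(H\<^sup>k)\<^sub>u\<^sub>v = 0\<close> for all \<open>k\<close>. The minimal polynomial expresses
  every \<open>H\<^sup>k\<close> with \<open>k \<ge> s\<close> as a combination of the \<open>s\<close> preceding powers, and \<open>H\<^sup>0\<close> contributes
  nothing off the diagonal.
\<close>

section \<open>Matrix powers and the entries of the exponential series\<close>

lemma matrix_scale_nth [simp]: "matrix_scale c M $ i $ j = c * M $ i $ j"
  by (simp add: matrix_scale_def)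

lemma matrix_pow_add: "matrix_pow M (a + b) = matrix_pow M a ** matrix_pow M b"
  by (induction a) (simp_all add: matrix_mul_assoc)

lemma matrix_pow_scale: "matrix_pow (matrix_scale c M) k = matrix_scale (c ^ k) (matrix_pow M k)"
proof (induction k)
  case 0
  show ?case by (simp add: vec_eq_iff)
next
  case (Suc k)
  then show ?case
    by (simp add: vec_eq_iff matrix_matrix_mult_def sum_distrib_left mult_ac)
qed

text \<open>Geometric growth makes the exponential series converge in each entry. A further factor
  \<open>M\<close> turns an entry into a sum of \<open>CARD('n)\<close> products, whence
  \<open>C\<close> is \<open>CARD('n)\<close> times \<open>norm M\<close>.\<close>

lemma matrix_pow_entry_bound:
  fixes M :: "complex^'n^'n"
  shows "\<exists>C. \<forall>k i j. norm (matrix_pow M k $ i $ j) \<le> C ^ k"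
proof -
  define B where "B = norm M"
  have B: "norm (M $ i $ j) \<le> B" for i j
    unfolding B_def by (meson Finite_Cartesian_Product.norm_nth_le order_trans)
  define C where "C = real CARD('n) * B"
  have "norm (matrix_pow M k $ i $ j) \<le> C ^ k" for k i j
  proof (induction k arbitrary: i)
    case 0
    show ?case by (simp add: mat_def)
  next
    case (Suc k)
    have "norm (matrix_pow M (Suc k) $ i $ j)
        \<le> (\<Sum>l\<in>UNIV. norm (M $ i $ l) * norm (matrix_pow M k $ l $ j))"
      by (simp add: matrix_matrix_mult_def flip: norm_mult) (rule norm_sum)
    also have "\<dots> \<le> (\<Sum>l\<in>(UNIV::'n set). B * C ^ k)"
      by (intro sum_mono mult_mono B Suc) (auto simp: B_def)
    also have "\<dots> = C ^ Suc k"
      by (simp add: C_def)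
    finally show ?case .
  qed
  then show ?thesis by blast
qed

lemma matrix_exp_entry_sums:
  fixes M :: "complex^'n^'n"
  shows   "(\<lambda>k. matrix_pow M k $ i $ j / fact k) sums (matrix_exp M $ i $ j)"
proof -
  let ?f = "\<lambda>k. matrix_scale (1 / fact k) (matrix_pow M k)"
  obtain C where C: "\<And>k i j. norm (matrix_pow M k $ i $ j) \<le> C ^ k"
    using matrix_pow_entry_bound[of M] by blast
  have entries: "summable (\<lambda>k. ?f k $ i $ j)" for i j
  proof (rule summable_comparison_test')
    show "summable (\<lambda>k. C ^ k / fact k)"
      using summable_exp[of C] by (simp add: field_simps)
    show "norm (?f k $ i $ j) \<le> C ^ k / fact k" if "k \<ge> 0" for k
      using C[of k i j] by (simp add: norm_divide divide_right_mono)
  qed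
  \<comment> \<open>\<open>matrix_exp\<close> is a \<open>suminf\<close> of whole matrices, so
    taking entries is legitimate only once the matrix series is known to converge.\<close>
  have "?f sums (\<chi> i j. \<Sum>k. ?f k $ i $ j)"
    unfolding sums_def
    by (intro vec_tendstoI) (use summable_LIMSEQ[OF entries] in simp)
  then have "?f sums matrix_exp M"
    unfolding matrix_exp_def by (meson sums_summable summable_sums)
  then have "(\<lambda>k. ?f k $ i $ j) sums (matrix_exp M $ i $ j)"
    by (intro bounded_linear.sums[OF bounded_linear_vec_nth])
  then show ?thesis by simp
qed

lemma transition_matrix_entry_sums:
  "(\<lambda>k. ((- \<i>) ^ k * matrix_pow H k $ u $ v / fact k) * complex_of_real t ^ k)
     sums (transition_matrix H t $ u $ v)"
  using matrix_exp_entry_sums[of "matrix_scale (- \<i> * complex_of_real t) H" u v]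
  unfolding transition_matrix_def matrix_pow_scale power_mult_distrib matrix_scale_nth
  by (simp add: mult_ac)

section \<open>Zero transfer and isolated zeros of power series\<close>

lemma transition_matrix_entry_zero_iff:
  fixes H :: "complex^'n^'n"
  assumes "u \<noteq> v"
  shows "(\<forall>t\<ge>0. transition_matrix H t $ u $ v = 0) \<longleftrightarrow> (\<forall>k. matrix_pow H k $ u $ v = 0)"
proof
  assume zero: "\<forall>t\<ge>0. transition_matrix H t $ u $ v = 0"
  define a where "a k = (- \<i>) ^ k * matrix_pow H k $ u $ v / fact k" for k
  have sums: "(\<lambda>k. a k * complex_of_real t ^ k) sums (transition_matrix H t $ u $ v)" for t
    unfolding a_def by (rule transition_matrix_entry_sums)
  \<comment> \<open>Convergence is known only at real points; the real point
    \<open>norm z + 1\<close> has larger modulus than \<open>z\<close>.\<close>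
  have summable: "summable (\<lambda>k. a k * z ^ k)" for z
  proof (rule powser_inside)
    show "summable (\<lambda>k. a k * complex_of_real (norm z + 1) ^ k)"
      using sums by (rule sums_summable)
    show "norm z < norm (complex_of_real (norm z + 1))"
      by (simp only: norm_of_real)
  qed
  define f where "f z = (\<Sum>k. a k * z ^ k)" for z
  have f_of_real: "f (complex_of_real t) = transition_matrix H t $ u $ v" for t
    unfolding f_def using sums by (rule sums_unique[symmetric])
  have a0: "a 0 = 0"
    using assms by (simp add: a_def mat_def)
  show "\<forall>k. matrix_pow H k $ u $ v = 0"
  proof (rule allI, rule ccontr)
    fix m assume "matrix_pow H m $ u $ v \<noteq> 0"
    then have am: "a m \<noteq> 0"
      by (simp add: a_def)
    then have "m > 0"
      using a0 by (cases m) auto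
    have "(\<lambda>n. a n * (x - 0) ^ n) sums f x" if "norm (x - 0) < 1" for x
      unfolding f_def using summable by (simp add: summable_sums)
    moreover have "f 0 = 0"
      by (simp add: f_def a0)
    ultimately obtain r where r: "r > 0" "\<And>z. z \<in> cball 0 r - {0} \<Longrightarrow> f z \<noteq> 0"
      by (rule powser_0_nonzero[where \<xi> = 0 and f = f and a = a, OF zero_less_one _ _ am \<open>m > 0\<close>])
        (assumption, rule that)
    \<comment> \<open>The radius \<open>r\<close> is itself a point of the punctured disc and a time
      at which the entry is assumed to vanish.\<close>
    have "f (complex_of_real r) \<noteq> 0"
      using r by simp
    then show False
      using zero \<open>r > 0\<close> by (simp add: f_of_real)
  qed
next
  assume "\<forall>k. matrix_pow H k $ u $ v = 0"
  then have "(\<lambda>k. 0) sums (transition_matrix H t $ u $ v)" for t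
    using transition_matrix_entry_sums[of H u v t] by simp
  then show "\<forall>t\<ge>0. transition_matrix H t $ u $ v = 0"
    using sums_0 sums_unique2 by blast
qed

section \<open>Matrix polynomials, the minimal polynomial and its recurrence\<close>

lemma matrix_poly_nth:
  assumes "degree p \<le> n"
  shows "matrix_poly p M $ i $ j = (\<Sum>k\<le>n. coeff p k * matrix_pow M k $ i $ j)"
proof -
  have "matrix_poly p M $ i $ j = (\<Sum>k\<le>degree p. coeff p k * matrix_pow M k $ i $ j)"
    by (simp add: matrix_poly_def)
  also have "\<dots> = (\<Sum>k\<le>n. coeff p k * matrix_pow M k $ i $ j)"
    using assms by (intro sum.mono_neutral_left) (auto simp: coeff_eq_0)
  finally show ?thesis .
qed

lemma matrix_poly_diff: "matrix_poly (p - q) M = matrix_poly p M - matrix_poly q M"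
proof -
  define n where "n = max (degree p) (degree q)"
  have "degree p \<le> n" "degree q \<le> n" "degree (p - q) \<le> n"
    by (auto simp: n_def degree_diff_le_max)
  then show ?thesis
    by (simp add: vec_eq_iff matrix_poly_nth[where n = n] left_diff_distrib sum_subtractf)
qed

lemma matrix_poly_smult: "matrix_poly (smult c p) M = matrix_scale c (matrix_poly p M)"
  by (simp add: vec_eq_iff matrix_poly_nth[where n = "degree p"] degree_smult_le
      sum_distrib_left mult_ac)

text \<open>Linear dependence of a set does not see repetitions, so a repeated vector is treated
  apart, through the relation \<open>x i - x j = 0\<close>. Otherwise \<open>DIM('a) + 1\<close>
  distinct vectors are dependent.\<close>

lemma real_linear_relation:
  fixes x :: "nat \<Rightarrow> 'a::euclidean_space"
  obtains n c where "(\<Sum>k\<le>n. c k *\<^sub>R x k) = 0" "\<exists>k\<le>n. c k \<noteq> 0"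
proof (cases "inj x")
  case False
  then obtain i j where ij: "i < j" "x i = x j"
    by (metis injI linorder_neqE_nat)
  define c where "c k = (if k = i then 1 else if k = j then - 1 else 0 :: real)" for k
  have "(\<Sum>k\<le>j. c k *\<^sub>R x k) = (\<Sum>k\<in>{i, j}. c k *\<^sub>R x k)"
    using ij by (intro sum.mono_neutral_right) (auto simp: c_def)
  also have "\<dots> = 0"
    using ij by (simp add: c_def)
  finally show thesis
    by (rule that) (use ij in \<open>auto simp: c_def intro!: exI[of _ i]\<close>)
next
  case True
  define n where "n = DIM('a)"
  have inj: "inj_on x {..n}"
    using True by (rule inj_on_subset) simp
  have "dependent (x ` {..n})"
    by (rule dependent_biggerset) (use card_image[OF inj] in \<open>simp add: n_def\<close>)
  then obtain c where "(\<Sum>y\<in>x ` {..n}. c y *\<^sub>R y) = 0" "\<exists>y\<in>x ` {..n}. c y \<noteq> 0"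
    by (subst (asm) dependent_finite) auto
  then have "(\<Sum>k\<le>n. c (x k) *\<^sub>R x k) = 0" "\<exists>k\<le>n. c (x k) \<noteq> 0"
    by (auto simp: sum.reindex inj)
  then show thesis by (rule that)
qed

text \<open>Complex matrices form a finite-dimensional real space, so the powers of \<open>M\<close>
  satisfy a nontrivial real linear relation, which is read as a polynomial.\<close>

lemma annihilating_poly_exists:
  fixes M :: "complex^'n^'n"
  obtains q where "q \<noteq> 0" "matrix_poly q M = 0"
proof -
  obtain n c where c: "(\<Sum>k\<le>n. c k *\<^sub>R matrix_pow M k) = 0" "\<exists>k\<le>n. c k \<noteq> 0"
    by (rule real_linear_relation)
  define q where "q = (\<Sum>k\<le>n. monom (complex_of_real (c k)) k)"
  have coeff: "coeff q k = (if k \<le> n then complex_of_real (c k) else 0)" for k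
    by (simp add: q_def coeff_sum if_distrib)
  have "q \<noteq> 0"
    using c(2) by (metis coeff coeff_0 of_real_eq_0_iff)
  moreover have "degree q \<le> n"
    by (rule degree_le) (simp add: coeff)
  then have "matrix_poly q M $ i $ j = (\<Sum>k\<le>n. c k *\<^sub>R matrix_pow M k) $ i $ j" for i j
    by (simp add: matrix_poly_nth[where n = n] coeff scaleR_conv_of_real[where 'a = complex])
  then have "matrix_poly q M = 0"
    by (simp add: vec_eq_iff c(1))
  ultimately show thesis by (rule that)
qed

text \<open>The \<open>THE\<close> in \<open>minimal_poly\<close> is meaningful only after existence
  and uniqueness: an annihilator of least degree is made monic, and two monic candidates cannot
  differ.\<close>

lemma minimal_poly_monic_annihilates:
  "lead_coeff (minimal_poly M) = 1 \<and> matrix_poly (minimal_poly M) M = 0"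
proof -
  let ?P = "\<lambda>p. lead_coeff p = 1 \<and> matrix_poly p M = 0 \<and>
     (\<forall>q. q \<noteq> 0 \<and> matrix_poly q M = 0 \<longrightarrow> degree p \<le> degree q)"
  obtain q0 where "q0 \<noteq> 0 \<and> matrix_poly q0 M = 0"
    using annihilating_poly_exists by blast
  then obtain q where q: "q \<noteq> 0" "matrix_poly q M = 0"
    and least: "\<And>r. r \<noteq> 0 \<and> matrix_poly r M = 0 \<Longrightarrow> degree q \<le> degree r"
    using ex_has_least_nat[of "\<lambda>q. q \<noteq> 0 \<and> matrix_poly q M = 0" q0 degree] by blast
  have ex: "?P (smult (inverse (lead_coeff q)) q)"
    using q least by (auto simp: matrix_poly_smult vec_eq_iff)
  have unique: "p = r" if p: "?P p" and r: "?P r" for p r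
  proof (rule ccontr)
    assume "p \<noteq> r"
    have deg: "degree p = degree r"
      using p r by (metis leading_coeff_0_iff order_antisym zero_neq_one)
    \<comment> \<open>The nonzero annihilator \<open>p - r\<close> obeys minimality, yet the leading
      terms cancel in it.\<close>
    have "degree p \<le> degree (p - r)"
      using p r \<open>p \<noteq> r\<close> by (simp add: matrix_poly_diff)
    moreover have "degree (p - r) \<le> degree p"
      using deg by (intro degree_diff_le) auto
    ultimately have "degree (p - r) = degree p"
      by (rule order_antisym[rotated])
    moreover have "coeff (p - r) (degree p) = 0"
      using p r deg by simp
    ultimately have "lead_coeff (p - r) = 0"
      by (simp only:)
    then have "p - r = 0"
      by (simp only: leading_coeff_0_iff)
    with \<open>p \<noteq> r\<close> show False by simp
  qed
  have "\<exists>!p. ?P p"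
    by (rule ex1I, rule ex, rule unique[OF _ ex])
  from theI'[OF this] show ?thesis
    unfolding minimal_poly_def by blast
qed

text \<open>Multiply \<open>matrix_poly p M = 0\<close> by the power \<open>m\<close> of
  \<open>M\<close> and isolate the leading term.\<close>

lemma monic_annihilator_recurrence:
  assumes "lead_coeff p = 1" "matrix_poly p M = 0"
  shows "matrix_pow M (m + degree p) $ i $ j =
    - (\<Sum>k<degree p. coeff p k * matrix_pow M (m + k) $ i $ j)"
proof -
  have "(\<Sum>k\<le>degree p. coeff p k * matrix_pow M (m + k) $ i $ j)
      = (matrix_pow M m ** matrix_poly p M) $ i $ j"
    by (simp add: matrix_pow_add matrix_matrix_mult_def matrix_poly_nth[OF order_refl]
        sum_distrib_left mult_ac) (rule sum.swap)
  also have "\<dots> = 0"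
    by (simp add: assms matrix_matrix_mult_def)
  finally show ?thesis
    using assms(1) by (simp add: lessThan_Suc_atMost[symmetric] eq_neg_iff_add_eq_0 add.commute)
qed

lemma matrix_pow_entry_zero_from_initial:
  assumes "lead_coeff p = 1" "matrix_poly p M = 0"
    and "\<And>k. k < degree p \<Longrightarrow> matrix_pow M k $ i $ j = 0"
  shows "matrix_pow M k $ i $ j = 0"
proof (induction k rule: less_induct)
  case (less k)
  show ?case
  proof (cases "k < degree p")
    case True
    then show ?thesis by (rule assms(3))
  next
    case False
    then obtain m where k: "k = m + degree p"
      by (metis add.commute le_Suc_ex not_less)
    show ?thesis
      unfolding k monic_annihilator_recurrence[OF assms(1,2)]
      using less by (simp add: k)
  qed
qed

theorem theorem3p1:
  fixes E :: "'v::finite set set" and A :: "('v \<times> 'v) set"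
    and H :: "complex^'v^'v" and u v :: 'v and s :: nat
  assumes "mixed_graph E A"
    and "H = hermitian_adj E A"
    and "u \<noteq> v"
    and "s = degree (minimal_poly H)"
  shows "zero_transfer E A u v \<longleftrightarrow>
    (\<forall>k::nat. 1 \<le> k \<and> k \<le> s - 1 \<longrightarrow> matrix_pow H k $ u $ v = 0)"
proof -
  have "zero_transfer E A u v \<longleftrightarrow> (\<forall>k. matrix_pow H k $ u $ v = 0)"
    using transition_matrix_entry_zero_iff[OF assms(3)]
    by (simp add: zero_transfer_def assms(2))
  also have "\<dots> \<longleftrightarrow> (\<forall>k. 1 \<le> k \<and> k \<le> s - 1 \<longrightarrow> matrix_pow H k $ u $ v = 0)"
  proof
    assume init: "\<forall>k. 1 \<le> k \<and> k \<le> s - 1 \<longrightarrow> matrix_pow H k $ u $ v = 0"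
    \<comment> \<open>The recurrence also needs the power 0, which the range from 1 omits; its entry
      vanishes because \<open>u\<close> and \<open>v\<close> are distinct.\<close>
    have "matrix_pow H k $ u $ v = 0" if "k < s" for k
    proof (cases k)
      case 0
      then show ?thesis using assms(3) by (simp add: mat_def)
    next
      case (Suc l)
      then have "1 \<le> k \<and> k \<le> s - 1"
        using that by simp
      with init show ?thesis by blast
    qed
    then show "\<forall>k. matrix_pow H k $ u $ v = 0"
      using matrix_pow_entry_zero_from_initial minimal_poly_monic_annihilates assms(4) by metis
  qed simp
  finally show ?thesis .
qed

end
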